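(* Let $A$ be a closed subset of $G=[0,1]$ and let $\epsilon>0$. Let $f\in C(A)$ be such that $0\le f(x)\le 1$ for all $x\in A$, $f(0)=0$ if $0\in A$, and $f(1)=0$ if $1\in A$. Then there exists $p\in\mathcal{Q}'$ with $\sup_{x\in A}|p(x)-f(x)|<\epsilon$.
   Context: $C(A)$ denotes the continuous real-valued functions on $A$. $\mathcal{Q}'$ is the set of real univariate polynomials $p$ satisfying: (i) $p(x)\in(0,1)$ for all $x\in(0,1)$; (ii) $p(x)<0$ for all $x<0$; (iii) $p(x)<0$ for all $x>1$. *)

theory Defs
  imports "HOL-Computational_Algebra.Polynomial" "HOL-Library.Extended_Real"
begin

definition Q' :: "real poly set" where
  "Q' = {p. (\<forall>x. 0 < x \<and> x < 1 \<longrightarrow> 0 < poly p x \<and> poly p x < 1) \<and>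
            (\<forall>x<0. poly p x < 0) \<and>
            (\<forall>x>1. poly p x < 0)}"

text \<open>
  The supremum is taken in the extended reals, so that it is meaningful on every set
  (it is minus infinity on the empty set, where the real-valued \<open>Sup\<close> is unspecified).
\<close>

definition sup_dist_on :: "real set \<Rightarrow> (real \<Rightarrow> real) \<Rightarrow> (real \<Rightarrow> real) \<Rightarrow> ereal" where
  "sup_dist_on A g f = (SUP x\<in>A. ereal \<bar>g x - f x\<bar>)"

end

theory Submission
  imports Defs "HOL-Analysis.Analysis"
begin

text \<open>
  A polynomial of the form \<open>x (1 - x) q(x)\<close> with \<open>q > 0\<close> on the whole real line has
  exactly the sign pattern that \<^const>\<open>Q'\<close> asks for, so the task is to choose \<open>q\<close> such that
  the product is close to \<open>f\<close> on \<open>A\<close> and stays below \<open>1\<close> on \<open>[0,1]\<close>.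

  Fix a small \<open>\<delta>\<close> and replace \<open>f\<close> by \<open>h = max 0 (f - \<delta>)\<close>. This costs at most \<open>\<delta>\<close>, leaves
  room below \<open>1\<close> since \<open>h \<le> 1 - \<delta>\<close>, and makes \<open>h\<close> vanish on the part of \<open>A\<close> near the end
  points, because \<open>f\<close> is continuous and is \<open>0\<close> at any end point in \<open>A\<close>. Hence
  \<open>h(x) / (x (1 - x))\<close> is continuous on \<open>A\<close>; it can be extended to a nonnegative
  continuous \<open>w\<close> on \<open>[0,1]\<close> with \<open>x (1 - x) w(x) \<le> 1 - \<delta>\<close> (lemma
  \<open>divide_by_endpoint_factor\<close>). Finally, \<open>w\<close> is a uniform limit on \<open>[0,1]\<close> of polynomials
  that are positive on all of the real line: approximate \<open>sqrt w\<close>, square, and add a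
  small constant (lemma \<open>Weierstrass_globally_positive\<close>).
\<close>

lemma Weierstrass_poly:
  fixes f :: "real \<Rightarrow> real"
  assumes "compact S" "continuous_on S f" "0 < e"
  obtains p :: "real poly" where "\<And>x. x \<in> S \<Longrightarrow> \<bar>f x - poly p x\<bar> < e"
proof -
  obtain g where g: "real_polynomial_function g" "\<And>x. x \<in> S \<Longrightarrow> \<bar>f x - g x\<bar> < e"
    using Stone_Weierstrass_real_polynomial_function[OF assms] by blast
  obtain a n where "g = (\<lambda>x. \<Sum>i\<le>n. a i * x ^ i)"
    using g(1) real_polynomial_function_iff_sum by blast
  then have "poly (\<Sum>i\<le>n. monom (a i) i) x = g x" for x
    by (simp add: poly_sum poly_monom)
  with g(2) that show thesis
    by metis
qed

text \<open>
  Squares of polynomials are nonnegative everywhere, which is why the approximation is made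
  for the square root of \<open>w\<close>. Squaring is uniformly continuous on bounded sets, so it
  does not destroy the approximation.
\<close>

lemma Weierstrass_globally_positive:
  fixes w :: "real \<Rightarrow> real"
  assumes "compact S" and cont: "continuous_on S w"
    and nonneg: "\<And>x. x \<in> S \<Longrightarrow> 0 \<le> w x" and "0 < e"
  obtains q :: "real poly" where "\<And>x. 0 < poly q x" "\<And>x. x \<in> S \<Longrightarrow> \<bar>poly q x - w x\<bar> < e"
proof -
  let ?s = "\<lambda>x. sqrt (w x)"
  have cont_s: "continuous_on S ?s"
    using cont by (intro continuous_intros)
  then have "bounded (?s ` S)"
    using \<open>compact S\<close> compact_continuous_image compact_imp_bounded by blast
  then obtain M where M: "\<And>x. x \<in> S \<Longrightarrow> \<bar>?s x\<bar> \<le> M" and "0 < M"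
    by (auto simp: bounded_pos)
  define d where "d = min 1 (e / (2 * (2 * M + 1)))"
  have d: "0 < d" "d \<le> 1" "d \<le> e / (2 * (2 * M + 1))"
    using \<open>0 < e\<close> \<open>0 < M\<close> by (auto simp: d_def)
  have dM: "d * (2 * M + 1) \<le> e / 2"
    using pos_le_divide_eq[of "2 * (2 * M + 1)" d e] d(3) \<open>0 < M\<close> by (simp add: algebra_simps)
  obtain r where r: "\<And>x. x \<in> S \<Longrightarrow> \<bar>?s x - poly r x\<bar> < d"
    using Weierstrass_poly[OF \<open>compact S\<close> cont_s d(1)] by blast
  show thesis
  proof
    show "0 < poly (r\<^sup>2 + [:e / 4:]) x" for x
      using \<open>0 < e\<close> by (simp add: add_nonneg_pos)
  next
    fix x assume x: "x \<in> S"
    have "\<bar>poly r x + ?s x\<bar> \<le> 2 * M + 1"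
      using r[OF x] M[OF x] d(2) by linarith
    then have "\<bar>poly r x - ?s x\<bar> * \<bar>poly r x + ?s x\<bar> \<le> d * (2 * M + 1)"
      using r[OF x] d(1) by (intro mult_mono) auto
    moreover have "\<bar>(poly r x)\<^sup>2 - w x\<bar> = \<bar>poly r x - ?s x\<bar> * \<bar>poly r x + ?s x\<bar>"
      using nonneg[OF x] by (simp add: abs_mult[symmetric] algebra_simps power2_eq_square)
    ultimately have "\<bar>(poly r x)\<^sup>2 - w x\<bar> \<le> e / 2"
      using dM by linarith
    then have "\<bar>(poly r x)\<^sup>2 + e / 4 - w x\<bar> < e"
      using \<open>0 < e\<close> by linarith
    then show "\<bar>poly (r\<^sup>2 + [:e / 4:]) x - w x\<bar> < e"
      by simp
  qed
qed

text \<open>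
  The quotient \<open>h(x) / (x (1 - x))\<close> exists as a continuous function although \<open>x (1 - x)\<close>
  vanishes at the end points: the support of \<open>h\<close> lies in a compact set \<open>K\<close> that avoids them,
  so \<open>x (1 - x)\<close> has a positive lower bound \<open>c\<close> there, and dividing by
  \<open>max c (x (1 - x))\<close> instead changes nothing on \<open>A\<close>. Since this divisor is at
  least \<open>x (1 - x)\<close>, the bound \<open>B\<close> survives on all of \<open>[0,1]\<close>; extending \<open>h\<close> before
  dividing means that the extension need not vanish at the end points.
\<close>

lemma divide_by_endpoint_factor:
  fixes h :: "real \<Rightarrow> real"
  assumes "closed A" and contA: "continuous_on A h" and "0 \<le> B"
    and h: "\<And>x. x \<in> A \<Longrightarrow> 0 \<le> h x \<and> h x \<le> B"
    and "compact K" "K \<subseteq> {0<..<1}" and supp: "\<And>x. x \<in> A - K \<Longrightarrow> h x = 0"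
  obtains w where "continuous_on {0..1} w" "\<And>x. 0 \<le> w x"
    "\<And>x. x \<in> {0..1} \<Longrightarrow> x * (1 - x) * w x \<le> B"
    "\<And>x. x \<in> A \<Longrightarrow> x * (1 - x) * w x = h x"
proof -
  obtain H where H: "continuous_on UNIV H" "\<And>x. x \<in> A \<Longrightarrow> H x = h x"
      "\<And>x. 0 \<le> H x" "\<And>x. H x \<le> B"
    by (rule Tietze_closed_interval_1[of A h UNIV 0 B])
      (use contA h \<open>closed A\<close> \<open>0 \<le> B\<close> in auto)
  obtain c :: real where c: "0 < c" "\<And>x. x \<in> K \<Longrightarrow> c \<le> x * (1 - x)"
  proof (cases "K = {}")
    case True
    with that[of 1] show thesis by simp
  next
    case False
    have "continuous_on K (\<lambda>x. x * (1 - x))"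
      by (intro continuous_intros)
    then obtain k where k: "k \<in> K" "\<And>x. x \<in> K \<Longrightarrow> k * (1 - k) \<le> x * (1 - x)"
      using continuous_attains_inf[OF \<open>compact K\<close> False] by blast
    have "0 < k * (1 - k)"
      using k(1) \<open>K \<subseteq> {0<..<1}\<close> by (intro mult_pos_pos) auto
    with that k(2) show thesis by blast
  qed
  let ?m = "\<lambda>x. max c (x * (1 - x))"
  have m: "0 < ?m x" for x
    using c(1) by simp
  show thesis
  proof
    show "continuous_on {0..1} (\<lambda>x. H x / ?m x)"
      using m by (intro continuous_intros continuous_on_subset[OF H(1)])
        (auto simp: less_imp_neq[THEN not_sym])
    show "0 \<le> H x / ?m x" for x
      using H(3) m[of x] by (intro divide_nonneg_pos)
  next
    fix x :: real assume "x \<in> {0..1}"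
    have "x * (1 - x) * (H x / ?m x) \<le> ?m x * (H x / ?m x)"
      using H(3) m[of x] by (intro mult_right_mono) (auto intro: divide_nonneg_pos)
    also have "\<dots> \<le> B"
      using H(4) m[of x] by simp
    finally show "x * (1 - x) * (H x / ?m x) \<le> B" .
  next
    fix x assume x: "x \<in> A"
    show "x * (1 - x) * (H x / ?m x) = h x"
    proof (cases "x \<in> K")
      case True
      then have "?m x = x * (1 - x)"
        using c(2) by (simp add: max_def)
      with m[of x] H(2)[OF x] show ?thesis by auto
    next
      case False
      then show ?thesis
        using H(2)[OF x] supp x by simp
    qed
  qed
qed

lemma endpoint_factor_times_positive_in_Q':
  fixes q :: "real poly"
  assumes pos: "\<And>x. 0 < poly q x"
    and less: "\<And>x. 0 < x \<Longrightarrow> x < 1 \<Longrightarrow> x * (1 - x) * poly q x < 1"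
  shows "[:0, 1:] * [:1, - 1:] * q \<in> Q'"
  unfolding Q'_def using pos less
  by (auto intro!: mult_pos_pos mult_neg_pos[OF _ pos] simp: mult_neg_pos mult_pos_neg algebra_simps)

theorem corollary2p16:
  fixes A :: "real set" and f :: "real \<Rightarrow> real" and \<epsilon> :: real
  assumes "closed A" and "A \<subseteq> {0..1}"
    and "\<epsilon> > 0"
    and "continuous_on A f"
    and "\<forall>x\<in>A. 0 \<le> f x \<and> f x \<le> 1"
    and "0 \<in> A \<longrightarrow> f 0 = 0"
    and "1 \<in> A \<longrightarrow> f 1 = 0"
  shows "\<exists>p\<in>Q'. sup_dist_on A (poly p) f < ereal \<epsilon>"
proof -
  define \<delta> where "\<delta> = min (\<epsilon> / 3) (1 / 2)"
  have \<delta>: "0 < \<delta>" "\<delta> < 1" "2 * \<delta> < \<epsilon>"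
    using \<open>\<epsilon> > 0\<close> by (auto simp: \<delta>_def)
  define h where "h x = max 0 (f x - \<delta>)" for x
  define K where "K = A \<inter> f -` {\<delta>..}"
  have "compact A"
    using \<open>closed A\<close> \<open>A \<subseteq> {0..1}\<close> by (meson bounded_closed_interval bounded_subset compact_eq_bounded_closed)
  have "closed K"
    unfolding K_def using \<open>continuous_on A f\<close> \<open>closed A\<close> by (intro continuous_closed_preimage) auto
  then have "compact K"
    using compact_Int_closed[OF \<open>compact A\<close>] by (metis K_def inf.absorb_iff2 inf_le1)
  have K: "K \<subseteq> {0<..<1}"
  proof
    fix x assume "x \<in> K"
    then have x: "x \<in> A" "\<delta> \<le> f x"
      by (auto simp: K_def)
    then have "x \<noteq> 0" "x \<noteq> 1"
      using assms(6,7) \<delta>(1) by auto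
    then show "x \<in> {0<..<1}"
      using x(1) \<open>A \<subseteq> {0..1}\<close> by force
  qed
  have "continuous_on A h"
    unfolding h_def using \<open>continuous_on A f\<close> by (intro continuous_intros)
  moreover have "0 \<le> h x \<and> h x \<le> 1 - \<delta>" if "x \<in> A" for x
    using assms(5) that \<delta>(2) by (auto simp: h_def)
  moreover have "h x = 0" if "x \<in> A - K" for x
    using that by (auto simp: h_def K_def)
  ultimately obtain w where w: "continuous_on {0..1} w" "\<And>x. 0 \<le> w x"
      "\<And>x. x \<in> {0..1} \<Longrightarrow> x * (1 - x) * w x \<le> 1 - \<delta>"
      "\<And>x. x \<in> A \<Longrightarrow> x * (1 - x) * w x = h x"
    using divide_by_endpoint_factor[OF \<open>closed A\<close>, of h "1 - \<delta>" K] \<open>compact K\<close> K \<delta>(2)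
    by (metis diff_ge_0_iff_ge less_imp_le)
  obtain q where q: "\<And>x. 0 < poly q x" "\<And>x. x \<in> {0..1} \<Longrightarrow> \<bar>poly q x - w x\<bar> < \<delta>"
    using Weierstrass_globally_positive[OF compact_Icc w(1) w(2) \<delta>(1)] by blast
  have close: "\<bar>x * (1 - x) * poly q x - x * (1 - x) * w x\<bar> < \<delta>" if x: "x \<in> {0..1}" for x
  proof -
    have "0 \<le> x * (1 - x)" "x * (1 - x) \<le> 1"
      using x by (auto intro: mult_le_one)
    then have "\<bar>x * (1 - x)\<bar> * \<bar>poly q x - w x\<bar> \<le> 1 * \<bar>poly q x - w x\<bar>"
      by (intro mult_right_mono) auto
    then show ?thesis
      using q(2)[OF x] by (simp add: abs_mult[symmetric] right_diff_distrib)
  qed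
  let ?p = "[:0, 1:] * [:1, - 1:] * q"
  have p: "poly ?p x = x * (1 - x) * poly q x" for x
    by (simp add: algebra_simps)
  have "?p \<in> Q'"
  proof (rule endpoint_factor_times_positive_in_Q'[OF q(1)])
    fix x :: real assume "0 < x" "x < 1"
    then show "x * (1 - x) * poly q x < 1"
      using close[of x] w(3)[of x] by auto
  qed
  moreover have "sup_dist_on A (poly ?p) f \<le> ereal (2 * \<delta>)"
    unfolding sup_dist_on_def
  proof (rule SUP_least)
    fix x assume x: "x \<in> A"
    then have "\<bar>h x - f x\<bar> \<le> \<delta>"
      using assms(5) \<delta>(1) by (auto simp: h_def)
    moreover have "\<bar>poly ?p x - h x\<bar> < \<delta>"
      using close[of x] w(4)[OF x] x \<open>A \<subseteq> {0..1}\<close> unfolding p by auto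
    ultimately show "ereal \<bar>poly ?p x - f x\<bar> \<le> ereal (2 * \<delta>)"
      unfolding ereal_less_eq by linarith
  qed
  then have "sup_dist_on A (poly ?p) f < ereal \<epsilon>"
    using \<delta>(3) by (metis ereal_less_eq(3) less_ereal.simps(1) order_le_less_trans)
  ultimately show ?thesis by blast
qed

end
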